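(* If $G$ is a Hamiltonian graph with $|V(G)| \ge 150\,\alpha(G)^3$, then $G$ is pancyclic.
   Context: Graphs are finite, simple and undirected, with nonempty vertex set. A graph $G$ on $n$ vertices is Hamiltonian if it contains a cycle of length $n$ (a cycle passing through all vertices), and pancyclic if it contains a cycle of length $\ell$ for every integer $\ell$ with $3 \le \ell \le n$. $\alpha(G)$ is the independence number, i.e. the size of the largest subset of the vertex set that does not contain an edge. *)

theory Defs
  imports "Graph_Theory.Graph_Theory"
begin

text \<open>
  A finite simple undirected graph is a \<^locale>\<open>pair_graph\<close>: a finite vertex set
  \<^const>\<open>pverts\<close> with a symmetric loop-free set of arcs \<^const>\<open>parcs\<close>, each edge
  being represented by its two orientations. The locale admits the empty vertex set, which
  has to be excluded separately.
\<close>

text \<open>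
  \<^const>\<open>pre_digraph.cycle\<close> works on arc lists and accepts the back-and-forth walk along
  a single edge as a cycle of length 2; cycles of an undirected graph have length at least 3.
\<close>
definition has_cycle_of_length :: "'a pair_pre_digraph \<Rightarrow> nat \<Rightarrow> bool" where
  "has_cycle_of_length G l \<longleftrightarrow>
     3 \<le> l \<and> (\<exists>p. pre_digraph.cycle (with_proj G) p \<and> length p = l)"

definition hamiltonian :: "'a pair_pre_digraph \<Rightarrow> bool" where
  "hamiltonian G \<longleftrightarrow> has_cycle_of_length G (card (pverts G))"

definition pancyclic :: "'a pair_pre_digraph \<Rightarrow> bool" where
  "pancyclic G \<longleftrightarrow> (\<forall>l. 3 \<le> l \<and> l \<le> card (pverts G) \<longrightarrow> has_cycle_of_length G l)"

definition independent_set :: "'a pair_pre_digraph \<Rightarrow> 'a set \<Rightarrow> bool" where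
  "independent_set G S \<longleftrightarrow> S \<subseteq> pverts G \<and> (\<forall>u\<in>S. \<forall>v\<in>S. (u, v) \<notin> parcs G)"

definition independence_number :: "'a pair_pre_digraph \<Rightarrow> nat" where
  "independence_number G = Max {card S | S. independent_set G S}"

end

theory Submission
  imports Defs
begin

text \<open>
  Write k for the independence number. Lengths up to 50 k^2 + 1 do not use the Hamilton cycle. If
  l < 4 k, some vertex has more than (l - 2) k neighbours, and these contain a path on l - 1 vertices.
  If l \<ge> 4 k and there is no l-cycle, every breadth-first search level N at depth i \<ge> 1 with
  2 i + 1 \<le> l contains an independent set of size at least |N| / (l - 2). Taking the first level
  that is at least as large as its successor, deleting it with its two neighbouring levels, and
  repeating produces an independent set of size n / (3 (l - 2)), which is more than k.

  Longer cycles come from lowering the length of the Hamilton cycle one by one. A vertex with k + 2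
  neighbours on a cycle can be inserted into it. There are sets W and R of sizes at most 10 k^2 and
  5 k^2 such that every vertex outside R, in particular every vertex of W, has at least 5 k neighbours
  in W. Cut a short segment that meets W in fewer than 2 k vertices out of a cycle containing W, by
  means of a chord. The lost vertices of W can be inserted again, and after that any vertex
  outside R, so the length can be adjusted to be exactly one less than before. As long as almost
  all vertices are still on the cycle, the segment is chosen disjoint from W and R.
\<close>

text \<open>
  Compares vertices at depth t of a tree by their ancestors first, so that the descendants of any
  vertex form an interval of their level.
\<close>
primrec lex_key :: "('a \<Rightarrow> 'a) \<Rightarrow> ('a \<Rightarrow> nat) \<Rightarrow> nat \<Rightarrow> nat \<Rightarrow> 'a \<Rightarrow> nat" where
  "lex_key par lab K 0 x = 0"
| "lex_key par lab K (Suc t) x = lex_key par lab K t (par x) * K + lab x"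

section \<open>Graphs as adjacency relations\<close>

locale sgraph =
  fixes V :: "'a set" and E :: "'a \<Rightarrow> 'a \<Rightarrow> bool"
  assumes finite_V: "finite V"
    and E_sym: "E x y \<Longrightarrow> E y x"
    and E_irrefl: "\<not> E x x"
begin

definition indep :: "'a set \<Rightarrow> bool" where
  "indep S \<longleftrightarrow> (\<forall>x\<in>S. \<forall>y\<in>S. \<not> E x y)"

definition nbh :: "'a \<Rightarrow> 'a set \<Rightarrow> 'a set" where
  "nbh v S = {y \<in> S. E v y}"

text \<open>A cycle is its list of vertices, the closing edge being implicit, so that segments can
  be cut and reversed as lists; arc walks return only in the final translation.\<close>

definition cyc :: "'a list \<Rightarrow> bool" where
  "cyc xs \<longleftrightarrow> 3 \<le> length xs \<and> distinct xs \<and> successively E xs \<and> E (last xs) (hd xs)"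

lemma nbh_subset: "nbh v S \<subseteq> S"
  by (auto simp: nbh_def)

lemma nbh_mono: "S \<subseteq> T \<Longrightarrow> nbh v S \<subseteq> nbh v T"
  by (auto simp: nbh_def)

lemma finite_nbh: "finite S \<Longrightarrow> finite (nbh v S)"
  by (auto simp: nbh_def)

lemma not_indep_ordered:
  assumes "\<not> indep (f ` S)"
  shows "\<exists>i\<in>S. \<exists>j\<in>S. (i :: nat) < j \<and> E (f i) (f j)"
proof -
  obtain i j where "i \<in> S" "j \<in> S" "E (f i) (f j)"
    using assms by (auto simp: indep_def)
  then show ?thesis
    using E_sym E_irrefl by (metis linorder_neqE_nat)
qed

lemma successively_rev: "successively E xs \<Longrightarrow> successively E (rev xs)"
proof (induction xs)
  case (Cons x xs)
  then show ?case
    using E_sym by (auto simp: successively_Cons successively_append_iff last_rev)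
qed simp

lemma sorted_wrt_imp_distinct: "sorted_wrt (\<lambda>x y. (key x :: nat) < key y) xs \<Longrightarrow> distinct xs"
  by (induction xs) auto

subsection \<open>Monotone paths\<close>

text \<open>In the spirit of the Gallai-Roy theorem: directing edges towards larger keys and peeling
  off the sources repeatedly splits \<open>A\<close> into at most \<open>k\<close> independent
  layers, one of which has at least average size.\<close>

lemma mono_path_or_indep:
  fixes key :: "'a \<Rightarrow> nat"
  assumes "finite A" "inj_on key A"
    and "\<And>xs. \<lbrakk>set xs \<subseteq> A; successively E xs; sorted_wrt (\<lambda>x y. key x < key y) xs\<rbrakk>
           \<Longrightarrow> length xs \<le> k"
  shows "\<exists>I \<subseteq> A. indep I \<and> card A \<le> k * card I"
  using assms
proof (induction k arbitrary: A)
  case 0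
  have "A = {}"
  proof (rule ccontr)
    assume "A \<noteq> {}"
    then obtain a where "a \<in> A" by blast
    then show False using "0.prems"(3)[of "[a]"] by simp
  qed
  then show ?case by (auto simp: indep_def)
next
  case (Suc k)
  txt \<open>Every vertex outside \<open>B\<close> extends monotone paths downwards, so removing \<open>B\<close> shortens them.\<close>
  define B where "B = {x \<in> A. \<forall>y\<in>A. E x y \<longrightarrow> \<not> key y < key x}"
  have "B \<subseteq> A" by (auto simp: B_def)
  have B: "indep B"
    unfolding indep_def
  proof (intro ballI notI)
    fix x y assume "x \<in> B" "y \<in> B" "E x y"
    then have "key x = key y" "x \<in> A" "y \<in> A"
      using E_sym[of x y] by (auto simp: B_def intro: antisym leI)
    then have "x = y" using Suc.prems(2) by (auto dest: inj_onD)
    then show False using \<open>E x y\<close> E_irrefl by simp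
  qed
  have "\<exists>I \<subseteq> A - B. indep I \<and> card (A - B) \<le> k * card I"
  proof (rule Suc.IH)
    show "finite (A - B)" using Suc.prems by simp
    show "inj_on key (A - B)" using Suc.prems by (auto intro: inj_on_subset)
    fix xs assume xs: "set xs \<subseteq> A - B" "successively E xs" "sorted_wrt (\<lambda>x y. key x < key y) xs"
    show "length xs \<le> k"
    proof (cases xs)
      case (Cons a as)
      then have "a \<in> A" "a \<notin> B" using xs by auto
      then obtain y where y: "y \<in> A" "E a y" "key y < key a" by (auto simp: B_def)
      have "length (y # xs) \<le> Suc k"
      proof (rule Suc.prems(3))
        show "set (y # xs) \<subseteq> A" using y xs by auto
        show "successively E (y # xs)" using y xs Cons E_sym by auto
        show "sorted_wrt (\<lambda>x y. key x < key y) (y # xs)" using y xs Cons by auto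
      qed
      then show ?thesis by simp
    qed simp
  qed
  then obtain I where I: "I \<subseteq> A - B" "indep I" "card (A - B) \<le> k * card I" by blast
  have "card A = card (A - B) + card B"
    using \<open>B \<subseteq> A\<close> Suc.prems(1) by (metis add.commute card_Diff_subset card_mono finite_subset le_add_diff_inverse)
  then have le: "card A \<le> k * card I + card B" using I by simp
  show ?case
  proof (cases "card I \<le> card B")
    case True
    then have "k * card I \<le> k * card B" by (rule mult_le_mono2)
    then have "card A \<le> k * card B + card B" using le by linarith
    then have "card A \<le> Suc k * card B" by simp
    then show ?thesis using B \<open>B \<subseteq> A\<close> by blast
  next
    case False
    then have "card A \<le> Suc k * card I" using le by simp
    then show ?thesis using I by blast
  qed
qed

subsection \<open>Skipping and inserting vertices\<close>

lemma cyc_skip: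
  assumes "cyc (P @ Q @ S)" "P \<noteq> []" "S \<noteq> []" "3 \<le> length P + length S" "E (last P) (hd S)"
  shows "cyc (P @ S)"
  using assms by (auto simp: cyc_def successively_append_iff)

text \<open>The detour leaves \<open>P\<close> through \<open>x\<close> to the end of
  \<open>Q\<close>, runs back along \<open>Q\<close>, and rejoins \<open>S\<close> by the chord from
  \<open>hd Q\<close>.\<close>

lemma cyc_insert:
  assumes "cyc (P @ Q @ S)" "P \<noteq> []" "Q \<noteq> []" "S \<noteq> []" "x \<notin> set (P @ Q @ S)"
    and "E x (last P)" "E x (last Q)" "E (hd Q) (hd S)"
  shows "cyc (P @ [x] @ rev Q @ S)"
  using assms E_sym[OF assms(6)] successively_rev[of Q]
  by (auto simp: cyc_def successively_append_iff hd_append last_rev hd_rev successively_Cons)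

lemma strict_mono_enumeration:
  assumes "finite T" "2 * k + 1 \<le> card T"
  obtains t :: "nat \<Rightarrow> nat" where "strict_mono_on {..2 * k} t" "t ` {..2 * k} \<subseteq> T"
proof
  let ?t = "\<lambda>i. sorted_list_of_set T ! i"
  have len: "length (sorted_list_of_set T) = card T" by simp
  show "strict_mono_on {..2 * k} ?t"
    using assms len by (intro strict_mono_onI) (auto intro!: sorted_wrt_nth_less[OF strict_sorted_list_of_set])
  show "?t ` {..2 * k} \<subseteq> T"
  proof
    fix y assume "y \<in> ?t ` {..2 * k}"
    then obtain i where "y = ?t i" "i < length (sorted_list_of_set T)" using assms len by auto
    then show "y \<in> T" using assms(1) by (metis nth_mem set_sorted_list_of_set)
  qed
qed

text \<open>
  The successors on the cycle of the neighbours of \<open>x\<close> are not independent, and a chord between two of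
  them allows a detour through \<open>x\<close>. One neighbour is spent on the last entry of the list, whose
  successor would wrap around.
\<close>
lemma cyc_absorb:
  assumes "cyc xs" "x \<notin> set xs" "k + 2 \<le> card (nbh x (set xs))"
    and indep_le: "\<And>S. \<lbrakk>indep S; S \<subseteq> set xs\<rbrakk> \<Longrightarrow> card S \<le> k"
  shows "\<exists>ys. cyc ys \<and> set ys = insert x (set xs)"
proof -
  have dist: "distinct xs" and ne: "xs \<noteq> []" using assms(1) by (auto simp: cyc_def)
  define J where "J = {i. Suc i < length xs \<and> E x (xs ! i)}"
  have finJ: "finite J" by (rule finite_subset[of _ "{..<length xs}"]) (auto simp: J_def)
  have "nbh x (set xs) \<subseteq> insert (last xs) ((!) xs ` J)"
  proof
    fix y assume "y \<in> nbh x (set xs)"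
    then obtain i where i: "i < length xs" "y = xs ! i" "E x y"
      by (auto simp: nbh_def in_set_conv_nth)
    show "y \<in> insert (last xs) ((!) xs ` J)"
    proof (cases "Suc i < length xs")
      case False
      then have "i = length xs - 1" using i by simp
      then show ?thesis using i ne by (simp add: last_conv_nth)
    qed (use i in \<open>auto simp: J_def\<close>)
  qed
  then have "card (nbh x (set xs)) \<le> card (insert (last xs) ((!) xs ` J))"
    using finJ by (intro card_mono) auto
  also have "\<dots> \<le> Suc (card J)"
    using card_image_le[OF finJ, of "(!) xs"] finJ by (simp add: card_insert_if)
  finally have "k < card J" using assms(3) by simp
  also have "card J = card ((\<lambda>i. xs ! Suc i) ` J)"
    using dist by (intro card_image[symmetric] inj_onI) (auto simp: J_def nth_eq_iff_index_eq)
  finally have "\<not> indep ((\<lambda>i. xs ! Suc i) ` J)"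
    using indep_le[of "(\<lambda>i. xs ! Suc i) ` J"] by (fastforce simp: J_def)
  then obtain i j where ij: "i \<in> J" "j \<in> J" "i < j" "E (xs ! Suc i) (xs ! Suc j)"
    using not_indep_ordered[of "\<lambda>i. xs ! Suc i" J] by blast
  \<comment> \<open>\<open>P\<close> and \<open>Q\<close> end in the neighbours
    \<open>xs ! i\<close> and \<open>xs ! j\<close> of \<open>x\<close>, and the chord joins the
    heads of \<open>Q\<close> and \<open>S\<close>.\<close>
  define P Q S where "P = take (Suc i) xs" and "Q = take (j - i) (drop (Suc i) xs)"
    and "S = drop (Suc j) xs"
  have "take (Suc j) xs = P @ Q"
    using ij by (simp add: P_def Q_def take_add[symmetric])
  then have xs: "xs = P @ Q @ S"
    by (metis S_def append.assoc append_take_drop_id)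
  have len: "Suc j < length xs" "Suc i < length xs" using ij by (auto simp: J_def)
  have "cyc (P @ [x] @ rev Q @ S)"
  proof (rule cyc_insert)
    show "cyc (P @ Q @ S)" "x \<notin> set (P @ Q @ S)" using assms xs by auto
    show "P \<noteq> []" "Q \<noteq> []" "S \<noteq> []" using ij len by (auto simp: P_def Q_def S_def)
    show "E x (last P)" using ij len by (auto simp: P_def J_def take_Suc_conv_app_nth)
    show "E x (last Q)" using ij len by (auto simp: Q_def J_def last_conv_nth)
    show "E (hd Q) (hd S)" using ij len by (auto simp: Q_def S_def hd_drop_conv_nth)
  qed
  then show ?thesis using xs by (intro exI[of _ "P @ [x] @ rev Q @ S"]) auto
qed

text \<open>The vertex set of the cycle only grows under insertion, so neighbours counted on the
  original cycle remain available throughout.\<close>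

lemma cyc_absorb_set:
  assumes "finite A" "cyc xs" "A \<inter> set xs = {}"
    and "\<And>a. a \<in> A \<Longrightarrow> k + 2 \<le> card (nbh a (set xs))"
    and indep_le: "\<And>S. \<lbrakk>indep S; S \<subseteq> set xs \<union> A\<rbrakk> \<Longrightarrow> card S \<le> k"
  shows "\<exists>ys. cyc ys \<and> set ys = set xs \<union> A"
  using assms
proof (induction A rule: finite_induct)
  case (insert a A)
  have "\<exists>ys. cyc ys \<and> set ys = set xs \<union> A"
  proof (rule insert.IH)
    fix S assume "indep S" "S \<subseteq> set xs \<union> A"
    then show "card S \<le> k" by (intro insert.prems(4)) auto
  qed (use insert in auto)
  then obtain ys where ys: "cyc ys" "set ys = set xs \<union> A" by blast
  have "\<exists>zs. cyc zs \<and> set zs = insert a (set ys)"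
  proof (rule cyc_absorb)
    show "cyc ys" "a \<notin> set ys" using ys insert by auto
    have "k + 2 \<le> card (nbh a (set xs))" using insert by auto
    also have "\<dots> \<le> card (nbh a (set ys))"
      using ys by (intro card_mono finite_nbh nbh_mono finite_set) auto
    finally show "k + 2 \<le> card (nbh a (set ys))" .
    fix S assume "indep S" "S \<subseteq> set ys"
    then show "card S \<le> k" using insert.prems(4) ys by auto
  qed
  then show ?case using ys by auto
qed auto

text \<open>\<open>T\<close> marks positions in a window. Two of \<open>k + 1\<close> marked
  vertices are adjacent, and cutting along this chord loses only vertices of the window, among them
  a marked one. With \<open>L + 3 \<le> length xs\<close> at least three vertices survive.\<close>

lemma cyc_shorten:
  assumes "cyc xs" "T \<subseteq> {s..<s + L}" "s + L \<le> length xs" "2 * k + 1 \<le> card T" "L + 3 \<le> length xs"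
    and indep_le: "\<And>S. \<lbrakk>indep S; S \<subseteq> set xs\<rbrakk> \<Longrightarrow> card S \<le> k"
  shows "\<exists>ys p. cyc ys \<and> set ys \<subseteq> set xs \<and> set xs - set ys \<subseteq> (!) xs ` {s..<s + L}
           \<and> p \<in> T \<and> xs ! p \<notin> set ys"
proof -
  have dist: "distinct xs" using assms(1) by (auto simp: cyc_def)
  have "finite T" using assms(2) by (rule finite_subset) simp
  then obtain t where t: "strict_mono_on {..2 * k} t" "t ` {..2 * k} \<subseteq> T"
    using strict_mono_enumeration assms(4) by metis
  have tb: "s \<le> t i" "t i < s + L" "t i < length xs" "t i \<in> T" if "i \<le> 2 * k" for i
    using that t(2) assms(2,3) by force+
  have tl: "t i < t j" if "i < j" "j \<le> 2 * k" for i j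
    using t(1) that by (auto simp: strict_mono_on_def)
  txt \<open>Only every other marked position may carry an end of the chord, so that it skips a marked one.\<close>
  let ?f = "\<lambda>i. xs ! t (2 * i)"
  have "inj_on ?f {..k}"
  proof (rule inj_onI)
    fix i j assume ij: "i \<in> {..k}" "j \<in> {..k}" "xs ! t (2 * i) = xs ! t (2 * j)"
    then have "t (2 * i) = t (2 * j)" using dist tb by (simp add: nth_eq_iff_index_eq)
    then show "i = j" using tl[of "2 * i" "2 * j"] tl[of "2 * j" "2 * i"] ij
      by (cases i j rule: linorder_cases) auto
  qed
  then have "card (?f ` {..k}) = Suc k" by (simp add: card_image)
  moreover have "?f ` {..k} \<subseteq> set xs" using tb by auto
  ultimately have "\<not> indep (?f ` {..k})" using indep_le by fastforce
  then obtain i j where ij: "i < j" "j \<le> k" "E (?f i) (?f j)"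
    using not_indep_ordered[of ?f "{..k}"] by auto
  define a m b where "a = t (2 * i)" and "m = t (2 * i + 1)" and "b = t (2 * j)"
  have amb: "s \<le> a" "a < m" "m < b" "b < s + L" "b < length xs" "m \<in> T"
    using ij tl[of "2 * i" "2 * i + 1"] tl[of "2 * i + 1" "2 * j"] tb
    by (auto simp: a_def m_def b_def)
  define P Q S where "P = take (Suc a) xs" and "Q = take (b - Suc a) (drop (Suc a) xs)"
    and "S = drop b xs"
  have "take b xs = P @ Q"
    using amb take_add[of "Suc a" "b - Suc a" xs] by (simp add: P_def Q_def)
  then have xs: "xs = P @ Q @ S"
    by (metis S_def append.assoc append_take_drop_id)
  have lenQ: "length Q = b - Suc a" using amb by (simp add: Q_def)
  have nthQ: "Q ! i = xs ! (Suc a + i)" if "i < b - Suc a" for i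
    using that amb by (simp add: Q_def)
  have Q: "set Q = (!) xs ` {Suc a..<b}"
  proof
    show "set Q \<subseteq> (!) xs ` {Suc a..<b}"
      using lenQ nthQ by (auto simp: in_set_conv_nth)
    show "(!) xs ` {Suc a..<b} \<subseteq> set Q"
    proof
      fix y assume "y \<in> (!) xs ` {Suc a..<b}"
      then obtain i where i: "Suc a \<le> i" "i < b" "y = xs ! i" by auto
      then have "Q ! (i - Suc a) = y" "i - Suc a < length Q" using nthQ[of "i - Suc a"] lenQ by auto
      then show "y \<in> set Q" by (metis nth_mem)
    qed
  qed
  have "cyc (P @ S)"
  proof (rule cyc_skip)
    show "cyc (P @ Q @ S)" using assms(1) xs by simp
    show "P \<noteq> []" "S \<noteq> []" using amb by (auto simp: P_def S_def)
    show "3 \<le> length P + length S" using amb assms(5) by (auto simp: P_def S_def)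
    show "E (last P) (hd S)"
      using amb ij by (auto simp: P_def S_def take_Suc_conv_app_nth hd_drop_conv_nth a_def b_def)
  qed
  moreover have "set xs - set (P @ S) = set Q" "set (P @ S) \<subseteq> set xs"
    using dist unfolding xs by auto
  moreover have "xs ! m \<in> set Q" "set Q \<subseteq> (!) xs ` {s..<s + L}" using Q amb by auto
  ultimately show ?thesis using amb(6) by (intro exI[of _ "P @ S"] exI[of _ m]) blast
qed

subsection \<open>Cycles through levels of a tree\<close>

text \<open>Both ends are extended by their parents, which lie at depth \<open>i - 1\<close> and
  hence off the path, until the two branches meet: \<open>h\<close> new vertices on each side and
  one common ancestor.\<close>

lemma closes_through_common_ancestor:
  assumes "distinct ys" "successively E ys" "set ys \<subseteq> (\<Union>t\<in>{i..}. N t)"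
    and "hd ys \<in> N i" "last ys \<in> N i" "ys \<noteq> []"
    and "(par ^^ Suc h) (hd ys) = (par ^^ Suc h) (last ys)"
    and "(par ^^ h) (hd ys) \<noteq> (par ^^ h) (last ys)" "h < i"
    and par: "\<And>j x. x \<in> N (Suc j) \<Longrightarrow> par x \<in> N j \<and> E x (par x)"
    and disj: "\<And>i j. i \<noteq> j \<Longrightarrow> N i \<inter> N j = {}"
  shows "\<exists>zs. cyc zs \<and> length zs = length ys + 2 * h + 1 \<and> set zs \<subseteq> set ys \<union> (\<Union>t. N t)"
  using assms(1-9)
proof (induction h arbitrary: ys i)
  case 0
  then obtain j where i: "i = Suc j" by (metis less_nat_zero_code not0_implies_Suc)
  have ne: "hd ys \<noteq> last ys" using 0 by simp
  have len: "2 \<le> length ys"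
  proof (rule ccontr)
    assume "\<not> 2 \<le> length ys"
    then have "length ys = 1" using \<open>ys \<noteq> []\<close> by (cases ys; cases "tl ys") auto
    then show False using ne by (auto simp: length_Suc_conv)
  qed
  have p: "par (hd ys) \<in> N j" "E (hd ys) (par (hd ys))" "E (last ys) (par (hd ys))"
    using par[of "hd ys" j] par[of "last ys" j] 0 i by auto
  have "par (hd ys) \<notin> set ys"
  proof
    assume "par (hd ys) \<in> set ys"
    then obtain t where "t \<ge> i" "par (hd ys) \<in> N t" using 0 by blast
    then show False using disj[of t j] p i by auto
  qed
  then have "cyc (par (hd ys) # ys)"
    using 0 p len E_sym by (auto simp: cyc_def successively_Cons)
  then show ?case using p by (intro exI[of _ "par (hd ys) # ys"]) auto
next
  case (Suc h)
  then obtain j where i: "i = Suc j" by (metis less_nat_zero_code not0_implies_Suc)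
  let ?u = "par (hd ys)" and ?w = "par (last ys)"
  have p: "?u \<in> N j" "E (hd ys) ?u" "?w \<in> N j" "E (last ys) ?w"
    using par[of "hd ys" j] par[of "last ys" j] Suc.prems i by auto
  have notin: "x \<notin> set ys" if "x \<in> N j" for x
  proof
    assume "x \<in> set ys"
    then obtain t where "t \<ge> i" "x \<in> N t" using Suc.prems by blast
    then show False using disj[of t j] that i by auto
  qed
  have uw: "(par ^^ h) ?u \<noteq> (par ^^ h) ?w" "(par ^^ Suc h) ?u = (par ^^ Suc h) ?w"
    using Suc.prems(7,8) by (simp_all add: funpow_swap1)
  then have "?u \<noteq> ?w" by auto
  let ?zs = "?u # ys @ [?w]"
  have "\<exists>zs. cyc zs \<and> length zs = length ?zs + 2 * h + 1 \<and> set zs \<subseteq> set ?zs \<union> (\<Union>t. N t)"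
  proof (rule Suc.IH)
    show "distinct ?zs" using Suc.prems notin p \<open>?u \<noteq> ?w\<close> by auto
    show "successively E ?zs"
      using Suc.prems p E_sym[OF p(2)] by (auto simp: successively_append_iff successively_Cons)
    show "set ?zs \<subseteq> (\<Union>t\<in>{j..}. N t)"
    proof
      fix x assume "x \<in> set ?zs"
      then consider "x \<in> N j" | "x \<in> set ys" using p by auto
      then show "x \<in> (\<Union>t\<in>{j..}. N t)"
      proof cases
        case 2
        then obtain t where "t \<ge> i" "x \<in> N t" using Suc.prems by blast
        then show ?thesis using i by (auto intro!: bexI[of _ t])
      qed auto
    qed
    show "(par ^^ Suc h) (hd ?zs) = (par ^^ Suc h) (last ?zs)" using uw(2) by simp
    show "(par ^^ h) (hd ?zs) \<noteq> (par ^^ h) (last ?zs)" using uw(1) by simp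
  qed (use p Suc.prems i in auto)
  then show ?case using p by auto
qed

text \<open>A path on \<open>l - 1\<close> vertices of the level, monotone in the order that
  compares ancestors first, would contain a subpath that closes through a common ancestor to an
  \<open>l\<close>-cycle. So monotone paths have at most \<open>l - 2\<close> vertices.\<close>

lemma level_cycle_or_indep:
  assumes par: "\<And>j x. x \<in> N (Suc j) \<Longrightarrow> par x \<in> N j \<and> E x (par x)"
    and disj: "\<And>i j. i \<noteq> j \<Longrightarrow> N i \<inter> N j = {}"
    and N0: "N 0 = {v}" and NU: "\<And>t. N t \<subseteq> U" and finU: "finite U"
    and l: "1 \<le> i" "2 * i + 1 \<le> l"
    and nocyc: "\<And>zs. \<lbrakk>cyc zs; set zs \<subseteq> U\<rbrakk> \<Longrightarrow> length zs \<noteq> l"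
  shows "\<exists>I \<subseteq> N i. indep I \<and> card (N i) \<le> (l - 2) * card I"
proof -
  obtain lab :: "'a \<Rightarrow> nat" and K where lab: "lab ` U = {i. i < K}" "inj_on lab U"
    using finite_imp_inj_to_nat_seg[OF finU] by blast
  have labK: "lab x < K" if "x \<in> N t" for x t using lab NU that by auto
  let ?key = "lex_key par lab K"
  \<comment> \<open>The label is the last digit of the key in base \<open>K\<close>, recovered
    modulo \<open>K\<close>. At depth 0 the key is constant, but the level is a singleton.\<close>
  have inj_key: "inj_on (?key t) (N t)" for t
  proof (cases t)
    case (Suc m)
    show ?thesis
    proof (rule inj_onI)
      fix x y assume xy: "x \<in> N t" "y \<in> N t" "?key t x = ?key t y"
      then have "?key t x mod K = ?key t y mod K" by simp
      then have "lab x = lab y" using Suc labK xy by simp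
      then show "x = y" using lab(2) NU xy by (meson inj_onD subsetD)
    qed
  qed (use N0 in simp)
  \<comment> \<open>A reversed order of the parents would change the key by at least
    \<open>K\<close>, more than the labels can make up for.\<close>
  have key_par: "?key m (par x) \<le> ?key m (par y)"
    if "x \<in> N (Suc m)" "y \<in> N (Suc m)" "?key (Suc m) x \<le> ?key (Suc m) y" for m x y
  proof (rule ccontr)
    assume "\<not> ?key m (par x) \<le> ?key m (par y)"
    then have "Suc (?key m (par y)) * K \<le> ?key m (par x) * K" by (intro mult_le_mono1) simp
    then have "?key m (par y) * K + K \<le> ?key m (par x) * K" by simp
    then show False using that(3) labK[OF that(2)] by simp
  qed
  show ?thesis
  proof (rule mono_path_or_indep)
    show "finite (N i)" using finU NU by (rule finite_subset[rotated])
    show "inj_on (?key i) (N i)" by (rule inj_key)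
    fix xs assume xs: "set xs \<subseteq> N i" "successively E xs" "sorted_wrt (\<lambda>x y. ?key i x < ?key i y) xs"
    show "length xs \<le> l - 2"
    proof (rule ccontr)
      assume "\<not> length xs \<le> l - 2"
      then have len: "l - 1 \<le> length xs" by simp
      define q where "q t a = (par ^^ t) (xs ! a)" for t a
      have q0: "q 0 a = xs ! a" and qSuc: "q (Suc t) a = par (q t a)" for t a
        by (simp_all add: q_def)
      have qN: "q t a \<in> N (i - t)" if "t \<le> i" "a < length xs" for t a
        using that(1)
      proof (induction t)
        case 0
        then show ?case using xs(1) that by (auto simp: q0)
      next
        case (Suc t)
        then have "i - t = Suc (i - Suc t)" by simp
        then show ?case using Suc par by (simp add: qSuc)
      qed
      have qmono: "?key (i - t) (q t a) \<le> ?key (i - t) (q t b)"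
        if "t \<le> i" "a \<le> b" "b < length xs" for t a b
        using that(1)
      proof (induction t)
        case 0
        show ?case
          using sorted_wrt_nth_less[OF xs(3), of a b] that by (cases "a = b") (auto simp: q0)
      next
        case (Suc t)
        then have eq: "i - t = Suc (i - Suc t)" by simp
        have "q t a \<in> N (Suc (i - Suc t))" "q t b \<in> N (Suc (i - Suc t))"
          using qN[of t a] qN[of t b] Suc.prems that eq by auto
        then show ?case using key_par Suc eq by (simp add: qSuc)
      qed
      \<comment> \<open>By monotonicity along the path, ancestors that agree at two positions agree
        everywhere between.\<close>
      have qeq: "q t c = q t d"
        if "t \<le> i" "a \<le> c" "c \<le> d" "d \<le> b" "b < length xs" "q t a = q t b" for t a b c d
      proof -
        have "?key (i - t) (q t a) \<le> ?key (i - t) (q t c)" by (rule qmono) (use that in auto)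
        moreover have "?key (i - t) (q t c) \<le> ?key (i - t) (q t d)" by (rule qmono) (use that in auto)
        moreover have "?key (i - t) (q t d) \<le> ?key (i - t) (q t b)" by (rule qmono) (use that in auto)
        ultimately have "?key (i - t) (q t c) = ?key (i - t) (q t d)" using that by simp
        then show ?thesis using inj_key[of "i - t"] qN[of t c] qN[of t d] that by (auto dest: inj_onD)
      qed
      \<comment> \<open>\<open>H\<close> is the least height at which the first \<open>l - 1\<close>
        path vertices have a common ancestor; the root \<open>v\<close> bounds it by
        \<open>i\<close>.\<close>
      define H where "H = (LEAST t. q t 0 = q t (l - 2))"
      have l3: "3 \<le> l" using l by simp
      have "q i c = v" if "c < length xs" for c
        using qN[of i c] N0 that by simp
      moreover have "l - 2 < length xs" "0 < length xs" using len l3 by linarith+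
      ultimately have qi: "q i 0 = q i (l - 2)" by simp
      have H: "q H 0 = q H (l - 2)" "H \<le> i"
        using LeastI[of "\<lambda>t. q t 0 = q t (l - 2)", OF qi] Least_le[of "\<lambda>t. q t 0 = q t (l - 2)", OF qi]
        by (simp_all add: H_def)
      have Hmin: "q t 0 \<noteq> q t (l - 2)" if "t < H" for t
        using not_less_Least that unfolding H_def by blast
      have "distinct xs"
        using sorted_wrt_imp_distinct[OF xs(3)] by simp
      moreover have "l - 2 < length xs" "0 < length xs" "l - 2 \<noteq> 0" using len l3 by linarith+
      ultimately have "q 0 0 \<noteq> q 0 (l - 2)" by (simp add: q0 nth_eq_iff_index_eq)
      then obtain h where h: "H = Suc h" using H(1) by (cases H) auto
      have hne: "q h 0 \<noteq> q h (l - 2)" using Hmin h by simp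
      have "\<exists>j. Suc j \<le> l - 2 \<and> q h j \<noteq> q h (Suc j)"
      proof (rule ccontr)
        assume no: "\<not> ?thesis"
        have "q h j = q h 0" if "j \<le> l - 2" for j
          using that
        proof (induction j)
          case (Suc j)
          then show ?case using no by (metis Suc_leD)
        qed simp
        then show False using hne by (metis order_refl)
      qed
      then obtain j where j: "Suc j \<le> l - 2" "q h j \<noteq> q h (Suc j)" by blast
      txt \<open>
        Any window \<open>a \<le> j < b\<close> of the path closes through a common ancestor at height \<open>Suc h\<close>; its
        width is chosen to make the length \<open>l\<close>.
      \<close>
      define a b where "a = min j (2 * h)" and "b = a + (l - 2 * Suc h)"
      \<comment> \<open>Taking the minimum with \<open>2 * h\<close> keeps \<open>b\<close> at most
        \<open>l - 2\<close>, and \<open>2 * i + 1 \<le> l\<close> makes the width positive.\<close>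
      have ab: "a \<le> j" "Suc j \<le> b" "b \<le> l - 2" "b < length xs" "b - a = l - 2 * Suc h" "a < b"
        using j H(2) h l len by (auto simp: a_def b_def)
      have neq: "q h a \<noteq> q h b"
        using qeq[of h a j "Suc j" b] ab j(2) H(2) h by auto
      have eq: "q (Suc h) a = q (Suc h) b"
        using qeq[of "Suc h" 0 a b "l - 2"] ab H h len l3 by auto
      define ys where "ys = take (Suc (b - a)) (drop a xs)"
      have ys: "ys \<noteq> []" "hd ys = xs ! a" "last ys = xs ! b" "length ys = Suc (b - a)"
        using ab(4,6) by (auto simp: ys_def hd_drop_conv_nth take_Suc_conv_app_nth)
      have dec: "xs = take a xs @ ys @ drop (Suc (b - a)) (drop a xs)"
        unfolding ys_def append_take_drop_id ..
      have "\<exists>zs. cyc zs \<and> length zs = length ys + 2 * h + 1 \<and> set zs \<subseteq> set ys \<union> (\<Union>t. N t)"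
      proof (rule closes_through_common_ancestor[where i = i and par = par and N = N])
        show "distinct ys" using \<open>distinct xs\<close> by (simp add: ys_def)
        show "successively E ys"
          using xs(2) dec by (metis successively_append_iff)
        have "set ys \<subseteq> set xs" using dec by (metis Un_iff set_append subsetI)
        then show "set ys \<subseteq> (\<Union>t\<in>{i..}. N t)" using xs(1) by auto
        show "hd ys \<in> N i" "last ys \<in> N i" using xs(1) ab by (auto simp: ys)
        show "(par ^^ Suc h) (hd ys) = (par ^^ Suc h) (last ys)" using eq unfolding q_def ys .
        show "(par ^^ h) (hd ys) \<noteq> (par ^^ h) (last ys)" using neq unfolding q_def ys .
        show "h < i" using H h by simp
      qed (use ys par disj in auto)
      then obtain zs where zs: "cyc zs" "length zs = length ys + 2 * h + 1" "set zs \<subseteq> set ys \<union> (\<Union>t. N t)"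
        by blast
      have "set ys \<subseteq> set xs" using dec by (metis Un_iff set_append subsetI)
      then have "set zs \<subseteq> U" using zs(3) xs(1) NU by blast
      moreover have "length zs = l" using zs(2) ys(4) ab H h l by simp
      ultimately show False using nocyc zs(1) by blast
    qed
  qed
qed

subsection \<open>Breadth-first search\<close>

primrec ball :: "'a set \<Rightarrow> 'a \<Rightarrow> nat \<Rightarrow> 'a set" where
  "ball U v 0 = {v}"
| "ball U v (Suc j) = ball U v j \<union> {y \<in> U. \<exists>x\<in>ball U v j. E x y}"

definition sphere :: "'a set \<Rightarrow> 'a \<Rightarrow> nat \<Rightarrow> 'a set" where
  "sphere U v j = ball U v j - (\<Union>t<j. ball U v t)"

lemma ball_subset: "v \<in> U \<Longrightarrow> ball U v j \<subseteq> U"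
  by (induction j) auto

lemma sphere_subset: "v \<in> U \<Longrightarrow> sphere U v j \<subseteq> U"
  using ball_subset by (fastforce simp: sphere_def)

lemma sphere_disjoint: "i \<noteq> j \<Longrightarrow> sphere U v i \<inter> sphere U v j = {}"
  by (cases i j rule: linorder_cases) (auto simp: sphere_def)

lemma ball_imp_sphere: "x \<in> ball U v j \<Longrightarrow> \<exists>t\<le>j. x \<in> sphere U v t"
proof -
  assume x: "x \<in> ball U v j"
  define t where "t = (LEAST t. x \<in> ball U v t)"
  have "x \<in> ball U v t" "t \<le> j" "\<And>s. s < t \<Longrightarrow> x \<notin> ball U v s"
    using x unfolding t_def by (auto intro: LeastI Least_le dest: not_less_Least)
  then show ?thesis by (auto simp: sphere_def)
qed

lemma sphere_adjacent:
  assumes "x \<in> sphere U v j" "x \<in> U" "y \<in> U" "E x y"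
  shows "\<exists>t. t \<le> Suc j \<and> j \<le> Suc t \<and> y \<in> sphere U v t"
proof -
  have "y \<in> ball U v (Suc j)" using assms by (auto simp: sphere_def)
  then obtain t where t: "t \<le> Suc j" "y \<in> sphere U v t" using ball_imp_sphere by blast
  have "j \<le> Suc t"
  proof (rule ccontr)
    assume "\<not> j \<le> Suc t"
    moreover have "x \<in> ball U v (Suc t)"
      using t assms(2) E_sym[OF assms(4)] by (auto simp: sphere_def)
    ultimately show False using assms(1) by (auto simp: sphere_def simp del: ball.simps)
  qed
  then show ?thesis using t by blast
qed

lemma sphere_parent:
  assumes "x \<in> sphere U v (Suc j)"
  shows "\<exists>y\<in>sphere U v j. E x y"
proof -
  have x: "x \<in> ball U v (Suc j)" "\<And>t. t \<le> j \<Longrightarrow> x \<notin> ball U v t"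
    using assms by (auto simp: sphere_def simp del: ball.simps)
  then obtain y where y: "x \<in> U" "y \<in> ball U v j" "E y x" using x(2)[of j] by auto
  obtain t where t: "t \<le> j" "y \<in> sphere U v t" using ball_imp_sphere[OF y(2)] by blast
  have "t = j"
  proof (rule ccontr)
    assume "t \<noteq> j"
    moreover have "x \<in> ball U v (Suc t)" using t y by (auto simp: sphere_def)
    ultimately show False using x(2)[of "Suc t"] t by simp
  qed
  then show ?thesis using t y E_sym by blast
qed

text \<open>Neighbours of level \<open>i\<close> lie in levels \<open>i - 1\<close> to
  \<open>Suc i\<close>, so an independent set in level \<open>i\<close> can be united with any found
  after deleting these levels. By the choice of \<open>i\<close> they have at most three times the
  size of level \<open>i\<close>.\<close>

lemma no_cycle_imp_large_indep:
  assumes "finite U" "3 \<le> l" "4 * k \<le> l"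
    and "\<And>zs. \<lbrakk>cyc zs; set zs \<subseteq> U\<rbrakk> \<Longrightarrow> length zs \<noteq> l"
    and "\<And>S. \<lbrakk>indep S; S \<subseteq> U\<rbrakk> \<Longrightarrow> card S \<le> k"
  shows "\<exists>I \<subseteq> U. indep I \<and> card U \<le> 3 * (l - 2) * card I"
  using assms(1,4,5)
proof (induction "card U" arbitrary: U rule: less_induct)
  case less
  show ?case
  proof (cases "U = {}")
    case False
    then obtain v where v: "v \<in> U" by blast
    let ?N = "sphere U v"
    have NU: "?N t \<subseteq> U" for t using v by (rule sphere_subset)
    have finN: "finite (?N t)" for t using NU less.prems(1) by (rule finite_subset)
    have N0: "?N 0 = {v}" by (simp add: sphere_def)
    have "\<exists>i. card (?N (Suc i)) \<le> card (?N i)"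
    proof (rule ccontr)
      assume "\<not> ?thesis"
      then have lt: "card (?N i) < card (?N (Suc i))" for i by (simp add: not_le)
      have "i \<le> card (?N i)" for i
      proof (induction i)
        case (Suc i)
        then show ?case using lt[of i] by simp
      qed simp
      then have "Suc (card U) \<le> card (?N (Suc (card U)))" .
      then show False using card_mono[OF less.prems(1) NU, of "Suc (card U)"] by simp
    qed
    then obtain i where i: "card (?N (Suc i)) \<le> card (?N i)"
      and "\<And>t. t < i \<Longrightarrow> \<not> card (?N (Suc t)) \<le> card (?N t)"
      using exists_least_iff[of "\<lambda>i. card (?N (Suc i)) \<le> card (?N i)"] by blast
    then have incr: "card (?N t) < card (?N (Suc t))" if "t < i" for t using that by (simp add: not_le)
    have ne: "?N t \<noteq> {}" if "t \<le> i" for t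
    proof (cases t)
      case (Suc m)
      then show ?thesis using incr[of m] that by auto
    qed (simp add: N0)
    have prev: "card (?N t) \<le> card (?N i)" if "t \<in> {i - 1..Suc i}" for t
    proof -
      have "t = i - 1 \<or> t = i \<or> t = Suc i" using that by auto
      then show ?thesis using i incr[of "i - 1"] by (cases i) auto
    qed
    txt \<open>Representatives of the even levels are independent, which bounds the depth \<open>i\<close>.\<close>
    define r where "r t = (SOME x. x \<in> ?N (2 * t))" for t
    have r: "r t \<in> ?N (2 * t)" if "2 * t \<le> i" for t
      unfolding r_def using ne[OF that] by (simp add: some_in_eq)
    have lev: "s = t" if "x \<in> ?N s" "x \<in> ?N t" for x s t
      using sphere_disjoint[of s t U v] that by blast
    have "inj_on r {..i div 2}"
    proof (rule inj_onI)
      fix s t assume "s \<in> {..i div 2}" "t \<in> {..i div 2}" "r s = r t"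
      then show "s = t" using r[of s] r[of t] lev[of "r s" "2 * s" "2 * t"] by auto
    qed
    then have "card (r ` {..i div 2}) = Suc (i div 2)" by (simp add: card_image)
    moreover have "card (r ` {..i div 2}) \<le> k"
    proof (rule less.prems(3))
      show "r ` {..i div 2} \<subseteq> U"
      proof (rule image_subsetI)
        fix t assume "t \<in> {..i div 2}"
        then have "2 * t \<le> i" by auto
        then show "r t \<in> U" using r NU by blast
      qed
      show "indep (r ` {..i div 2})"
      proof (rule ccontr)
        assume "\<not> ?thesis"
        then obtain s t where st: "s < t" "t \<le> i div 2" "E (r s) (r t)"
          using not_indep_ordered[of r "{..i div 2}"] by auto
        then have rs: "r s \<in> ?N (2 * s)" "r t \<in> ?N (2 * t)" using r by auto
        then obtain u where "u \<le> Suc (2 * s)" "r t \<in> ?N u"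
          using sphere_adjacent[of "r s" U v "2 * s" "r t"] st NU by blast
        then show False using lev[of "r t" u "2 * t"] rs st by simp
      qed
    qed
    \<comment> \<open>\<open>Suc (i div 2) \<le> k\<close> means \<open>i \<le> 2 * k - 1\<close>,
      so \<open>2 * i + 1\<close> is at most \<open>4 * k - 1\<close>.\<close>
    ultimately have il: "2 * i + 1 \<le> l" using assms(3) by linarith
    have "\<exists>I \<subseteq> ?N i. indep I \<and> card (?N i) \<le> (l - 2) * card I"
    proof (cases "i = 0")
      case True
      then show ?thesis
        using N0 assms(2) E_irrefl by (intro exI[of _ "{v}"]) (auto simp: indep_def)
    next
      case False
      \<comment> \<open>The depth is quantified inside the choice so that one function serves all
        levels; disjointness of the levels recovers it.\<close>
      define par where "par x = (SOME y. \<exists>j. x \<in> ?N (Suc j) \<and> y \<in> ?N j \<and> E x y)" for x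
      have par: "par x \<in> ?N j \<and> E x (par x)" if "x \<in> ?N (Suc j)" for j x
      proof -
        have "\<exists>y j. x \<in> ?N (Suc j) \<and> y \<in> ?N j \<and> E x y" using sphere_parent that by blast
        then have "\<exists>j. x \<in> ?N (Suc j) \<and> par x \<in> ?N j \<and> E x (par x)"
          unfolding par_def by (rule someI_ex)
        then show ?thesis using lev that by blast
      qed
      show ?thesis
        by (rule level_cycle_or_indep[where par = par and v = v and U = U])
          (use par sphere_disjoint N0 NU less.prems il False in auto)
    qed
    then obtain I where I: "I \<subseteq> ?N i" "indep I" "card (?N i) \<le> (l - 2) * card I" by blast
    \<comment> \<open>For \<open>i = 0\<close> the truncated \<open>i - 1\<close> leaves just the
      levels 0 and 1.\<close>
    define M where "M = (\<Union>t\<in>{i - 1..Suc i}. ?N t)"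
    have MU: "M \<subseteq> U" using NU by (auto simp: M_def)
    have "?N i \<subseteq> M" "?N i \<noteq> {}" using ne unfolding M_def by (intro UN_upper, auto)
    have "card M \<le> (\<Sum>t\<in>{i - 1..Suc i}. card (?N t))"
      unfolding M_def by (rule card_UN_le) simp
    also have "\<dots> \<le> card {i - 1..Suc i} * card (?N i)"
      using sum_bounded_above[of "{i - 1..Suc i}" "\<lambda>t. card (?N t)" "card (?N i)"] prev by simp
    also have "\<dots> \<le> 3 * card (?N i)" by (intro mult_le_mono1) auto
    finally have M: "card M \<le> 3 * card (?N i)" .
    have lt: "card (U - M) < card U"
      using \<open>?N i \<subseteq> M\<close> \<open>?N i \<noteq> {}\<close> MU less.prems(1) by (intro psubset_card_mono) auto
    have "\<exists>J \<subseteq> U - M. indep J \<and> card (U - M) \<le> 3 * (l - 2) * card J"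
    proof (rule less.hyps[OF lt])
      show "finite (U - M)" using less.prems by simp
      show "length zs \<noteq> l" if "cyc zs" "set zs \<subseteq> U - M" for zs using less.prems(2) that by blast
      show "card S \<le> k" if "indep S" "S \<subseteq> U - M" for S using less.prems(3) that by blast
    qed
    then obtain J where J: "J \<subseteq> U - M" "indep J" "card (U - M) \<le> 3 * (l - 2) * card J" by blast
    have no: "\<not> E x y" if "x \<in> I" "y \<in> J" for x y
    proof
      assume "E x y"
      have "x \<in> ?N i" "x \<in> U" "y \<in> U" using that I(1) J(1) NU[of i] by auto
      with \<open>E x y\<close> obtain t where "t \<le> Suc i" "i \<le> Suc t" "y \<in> ?N t"
        using sphere_adjacent[of x U v i y] by blast
      then show False using that J by (auto simp: M_def)
    qed
    have "\<not> E y x" if "x \<in> I" "y \<in> J" for x y using no[OF that] E_sym[of y x] by blast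
    then have "indep (I \<union> J)" using I(2) J(2) no by (auto simp: indep_def)
    moreover have "I \<union> J \<subseteq> U" using I J NU by blast
    moreover have "card U \<le> 3 * (l - 2) * card (I \<union> J)"
    proof -
      have c: "card (I \<union> J) = card I + card J"
      proof (rule card_Un_disjoint)
        show "finite I" "finite J" using \<open>I \<union> J \<subseteq> U\<close> less.prems(1) by (auto intro: finite_subset)
        show "I \<inter> J = {}" using I J \<open>?N i \<subseteq> M\<close> by blast
      qed
      have "card U = card M + card (U - M)"
        using MU less.prems(1) by (metis card_Diff_subset card_mono finite_subset le_add_diff_inverse)
      moreover have "card M \<le> 3 * (l - 2) * card I" using M I(3) by simp
      ultimately have "card U \<le> 3 * (l - 2) * card I + 3 * (l - 2) * card J"
        using J(3) by linarith
      then show ?thesis unfolding c by (simp only: distrib_left)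
    qed
    ultimately show ?thesis by blast
  qed (auto simp: indep_def)
qed

subsection \<open>Dominating cores\<close>

text \<open>Greedy choice: take a vertex of degree below \<open>D\<close> and delete it with its
  neighbours, at most \<open>D\<close> vertices for each one gained.\<close>

lemma degenerate_imp_large_indep:
  assumes "finite S"
    and "\<And>T. \<lbrakk>T \<subseteq> S; T \<noteq> {}\<rbrakk> \<Longrightarrow> \<exists>v\<in>T. card (nbh v T) < D"
  shows "\<exists>I \<subseteq> S. indep I \<and> card S \<le> D * card I"
  using assms
proof (induction "card S" arbitrary: S rule: less_induct)
  case less
  show ?case
  proof (cases "S = {}")
    case False
    then obtain v where v: "v \<in> S" "card (nbh v S) < D" using less.prems(2) by blast
    define M where "M = insert v (nbh v S)"
    have MS: "M \<subseteq> S" using v by (auto simp: M_def nbh_def)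
    have cM: "card M \<le> D"
      using v card_insert_le_m1[of D "nbh v S" v] unfolding M_def by (simp add: card_insert_if finite_nbh less.prems)
    have "card (S - M) < card S"
      using v MS less.prems(1) by (intro psubset_card_mono) (auto simp: M_def)
    then have "\<exists>J \<subseteq> S - M. indep J \<and> card (S - M) \<le> D * card J"
      by (rule less.hyps) (use less.prems in auto)
    then obtain J where J: "J \<subseteq> S - M" "indep J" "card (S - M) \<le> D * card J" by blast
    have "finite J" using J less.prems(1) by (meson finite_Diff finite_subset)
    have "v \<notin> J" using J by (auto simp: M_def)
    have no: "\<not> E v y" if "y \<in> J" for y using J that by (auto simp: M_def nbh_def)
    then have "\<not> E y v" if "y \<in> J" for y using that E_sym by blast
    then have "indep (insert v J)" using no J E_irrefl by (auto simp: indep_def)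
    moreover have "card S = card M + card (S - M)"
      using MS less.prems(1) by (metis card_Diff_subset card_mono finite_subset le_add_diff_inverse)
    then have "card S \<le> D * card (insert v J)"
      using cM J \<open>finite J\<close> \<open>v \<notin> J\<close> by simp
    ultimately show ?thesis using J v by (intro exI[of _ "insert v J"]) auto
  qed (auto simp: indep_def)
qed

text \<open>
  \<open>W\<close> is maximal among the \<open>2 * d\<close>-degenerate sets of minimum degree \<open>d\<close>. If \<open>R\<close>, the set of vertices
  with fewer than \<open>d\<close> neighbours in \<open>W\<close>, were not degenerate, then a minimal subset of \<open>R\<close> of
  minimum degree \<open>d\<close> could be added to \<open>W\<close>.
\<close>
lemma dominating_core:
  assumes "finite U" "1 \<le> d" and k: "\<And>S. \<lbrakk>indep S; S \<subseteq> U\<rbrakk> \<Longrightarrow> card S \<le> k"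
  shows "\<exists>W R. W \<subseteq> U \<and> finite R \<and> W \<inter> R = {} \<and> card W \<le> 2 * d * k \<and> card R \<le> d * k
    \<and> (\<forall>v\<in>U - R. d \<le> card (nbh v W))"
proof -
  define P where "P W \<longleftrightarrow> W \<subseteq> U \<and> (\<forall>v\<in>W. d \<le> card (nbh v W))
    \<and> (\<forall>T. T \<subseteq> W \<and> T \<noteq> {} \<longrightarrow> (\<exists>v\<in>T. card (nbh v T) < 2 * d))" for W
  have "finite {W. P W}" "{} \<in> {W. P W}"
    using assms(1) by (auto simp: P_def intro: finite_subset[of _ "Pow U"])
  from finite_has_maximal2[OF this]
  obtain W where W: "P W" and max: "\<And>W'. \<lbrakk>P W'; W \<subseteq> W'\<rbrakk> \<Longrightarrow> W = W'"
    by blast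
  have Wdeg: "d \<le> card (nbh v W)" if "v \<in> W" for v using W that by (simp add: P_def)
  have Wdgn: "\<exists>v\<in>T. card (nbh v T) < 2 * d" if "T \<subseteq> W" "T \<noteq> {}" for T
    using W that by (simp add: P_def)
  have WU: "W \<subseteq> U" and finW: "finite W" using W assms(1) by (auto simp: P_def intro: finite_subset)
  define R where "R = {v \<in> U - W. card (nbh v W) < d}"
  have R: "\<exists>v\<in>T. card (nbh v T) < d" if T: "T \<subseteq> R" "T \<noteq> {}" for T
  proof (rule ccontr)
    assume "\<not> ?thesis"
    define Q where "Q S \<longleftrightarrow> S \<subseteq> R \<and> S \<noteq> {} \<and> (\<forall>v\<in>S. d \<le> card (nbh v S))" for S
    have "finite {S. Q S}" "T \<in> {S. Q S}"
      using assms(1) T \<open>\<not> (\<exists>v\<in>T. card (nbh v T) < d)\<close>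
      by (auto simp: Q_def R_def not_less intro: finite_subset[of _ "Pow U"])
    from finite_has_minimal2[OF this]
    obtain S where "Q S" and min: "\<And>T. \<lbrakk>Q T; T \<subseteq> S\<rbrakk> \<Longrightarrow> S = T"
      by blast
    then have S: "S \<subseteq> R" "S \<noteq> {}" "\<And>v. v \<in> S \<Longrightarrow> d \<le> card (nbh v S)"
      and Smin: "\<And>T. \<lbrakk>T \<subseteq> R; T \<noteq> {}; \<forall>v\<in>T. d \<le> card (nbh v T); T \<subseteq> S\<rbrakk> \<Longrightarrow> S = T"
      by (auto simp: Q_def)
    have finS: "finite S" and SW: "S \<inter> W = {}"
      using S(1) assms(1) by (auto simp: R_def intro: finite_subset[of _ U])
    \<comment> \<open>Proper subsets of \<open>S\<close> have a vertex of degree below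
      \<open>d\<close> by minimality. In \<open>S\<close> itself, deleting one vertex must push some
      degree below \<open>d\<close>, and it lowers each degree by at most one.\<close>
    have small: "\<exists>v\<in>T. card (nbh v T) \<le> d" if T: "T \<subseteq> S" "T \<noteq> {}" for T
    proof (cases "T = S")
      case False
      then have "\<not> (\<forall>v\<in>T. d \<le> card (nbh v T))" using Smin[of T] T S(1) by auto
      then show ?thesis by force
    next
      case True
      obtain u where u: "u \<in> S" using S(2) by blast
      show ?thesis
      proof (cases "S = {u}")
        case True
        then have "nbh u S = {}" using E_irrefl by (auto simp: nbh_def)
        then show ?thesis using S(3)[OF u] assms(2) by simp
      next
        case False
        then have "\<not> (\<forall>v\<in>S - {u}. d \<le> card (nbh v (S - {u})))"
          using Smin[of "S - {u}"] S(1) u by blast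
        then obtain v where v: "v \<in> S" "card (nbh v (S - {u})) < d" by (auto simp: not_le)
        have "card (nbh v S) \<le> card (insert u (nbh v (S - {u})))"
          using finS by (intro card_mono) (auto simp: nbh_def)
        also have "\<dots> \<le> Suc (card (nbh v (S - {u})))"
          using finS by (simp add: card_insert_if finite_nbh)
        finally have "card (nbh v S) \<le> d" using v by simp
        then show ?thesis using v \<open>T = S\<close> by blast
      qed
    qed
    have "P (W \<union> S)"
      unfolding P_def
    proof (intro conjI ballI allI impI)
      show "W \<union> S \<subseteq> U" using WU S(1) by (auto simp: R_def)
      fix v assume "v \<in> W \<union> S"
      then show "d \<le> card (nbh v (W \<union> S))"
      proof
        assume "v \<in> W"
        then have "d \<le> card (nbh v W)" by (rule Wdeg)
        also have "\<dots> \<le> card (nbh v (W \<union> S))"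
          using finS finW by (intro card_mono finite_nbh nbh_mono) auto
        finally show ?thesis .
      next
        assume "v \<in> S"
        then have "d \<le> card (nbh v S)" using S(3) by auto
        also have "\<dots> \<le> card (nbh v (W \<union> S))"
          using finS finW by (intro card_mono finite_nbh nbh_mono) auto
        finally show ?thesis .
      qed
    next
      fix T assume T: "T \<subseteq> W \<union> S \<and> T \<noteq> {}"
      show "\<exists>v\<in>T. card (nbh v T) < 2 * d"
      proof (cases "T \<inter> S = {}")
        case True
        then have "T \<subseteq> W" using T by blast
        then show ?thesis using T Wdgn by blast
      next
        case False
        \<comment> \<open>Such a \<open>v\<close> has at most \<open>d\<close> neighbours in
          \<open>T \<inter> S\<close> and, lying in \<open>R\<close>, fewer than \<open>d\<close> in
          \<open>W\<close>; hence the bound \<open>2 * d\<close>.\<close>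
        obtain v where v: "v \<in> T" "v \<in> S" "card (nbh v (T \<inter> S)) \<le> d"
          using small[OF Int_lower2 False] by blast
        have "card (nbh v T) \<le> card (nbh v (T \<inter> S) \<union> nbh v W)"
        proof (rule card_mono)
          show "finite (nbh v (T \<inter> S) \<union> nbh v W)" using finS finW by (simp add: finite_nbh)
          show "nbh v T \<subseteq> nbh v (T \<inter> S) \<union> nbh v W" using T unfolding nbh_def by blast
        qed
        also have "\<dots> \<le> card (nbh v (T \<inter> S)) + card (nbh v W)" by (rule card_Un_le)
        also have "card (nbh v W) < d" using v S(1) by (auto simp: R_def)
        finally have "card (nbh v T) < 2 * d" using v(3) by simp
        then show ?thesis using v(1) by blast
      qed
    qed
    then have "W = W \<union> S" using max by blast
    then show False using SW S(2) by blast
  qed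
  have finR: "finite R" using assms(1) by (simp add: R_def)
  show ?thesis
  proof (intro exI conjI ballI)
    show "W \<subseteq> U" by (rule WU)
    show "finite R" by (rule finR)
    show "W \<inter> R = {}" by (auto simp: R_def)
    obtain I where I: "I \<subseteq> W" "indep I" "card W \<le> 2 * d * card I"
      using degenerate_imp_large_indep[OF finW Wdgn] by blast
    have "card W \<le> 2 * d * card I" by (rule I)
    also have "\<dots> \<le> 2 * d * k" using k[OF I(2)] I(1) WU by (intro mult_le_mono2) auto
    finally show "card W \<le> 2 * d * k" .
    obtain J where J: "J \<subseteq> R" "indep J" "card R \<le> d * card J"
      using degenerate_imp_large_indep[OF finR R] by blast
    have "card R \<le> d * card J" by (rule J)
    also have "\<dots> \<le> d * k" using k[OF J(2)] J(1) by (intro mult_le_mono2) (auto simp: R_def)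
    finally show "card R \<le> d * k" .
    fix v assume "v \<in> U - R"
    then show "d \<le> card (nbh v W)" using Wdeg by (cases "v \<in> W") (auto simp: R_def)
  qed
qed

subsection \<open>Lowering the length of a cycle\<close>

text \<open>Pigeonhole over \<open>b\<close> consecutive disjoint blocks of length
  \<open>L\<close>.\<close>

lemma block_with_few:
  assumes "distinct xs" "b * L \<le> length xs" "finite X" "card X < b * c"
  shows "\<exists>s. s + L \<le> length xs \<and> card {p \<in> {s..<s + L}. xs ! p \<in> X} < c"
proof (rule ccontr)
  assume no: "\<not> ?thesis"
  define B where "B s = {p \<in> {s * L..<s * L + L}. xs ! p \<in> X}" for s
  have fit: "s * L + L \<le> length xs" if "s < b" for s
  proof -
    have "Suc s * L \<le> b * L" using that by (intro mult_le_mono1) simp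
    then show ?thesis using assms(2) by simp
  qed
  have "c \<le> card (B s)" if "s < b" for s using no fit[OF that] by (auto simp: B_def not_less)
  then have "b * c \<le> (\<Sum>s<b. card (B s))" using sum_bounded_below[of "{..<b}" c "\<lambda>s. card (B s)"] by simp
  also have "\<dots> = card (\<Union>s<b. B s)"
  proof (rule card_UN_disjoint[symmetric])
    have "s = t" if "p \<in> B s" "p \<in> B t" for p s t
    proof -
      have "p div L = u" if "p \<in> B u" for u
        using that by (intro div_nat_eqI) (auto simp: B_def algebra_simps)
      then show ?thesis using that by blast
    qed
    then show "\<forall>i\<in>{..<b}. \<forall>j\<in>{..<b}. i \<noteq> j \<longrightarrow> B i \<inter> B j = {}" by blast
  qed (auto simp: B_def)
  also have "\<dots> \<le> card X"
  proof (rule card_inj_on_le)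
    have lt: "p < length xs" if "s < b" "p \<in> B s" for s p
      using fit[OF that(1)] that(2) by (simp add: B_def)
    show "inj_on ((!) xs) (\<Union>s<b. B s)"
      using assms(1) lt by (intro inj_onI) (auto simp: nth_eq_iff_index_eq)
    show "(!) xs ` (\<Union>s<b. B s) \<subseteq> X" by (auto simp: B_def)
  qed (rule assms(3))
  finally show False using assms(4) by simp
qed

text \<open>A cut inside the block loses fewer than \<open>2 * k\<close> vertices of
  \<open>W\<close>, so each of these keeps \<open>k + 2\<close> of its \<open>3 * k + 2\<close>
  neighbours in \<open>W\<close> and can be reinserted. The cycle is then filled up with vertices
  outside \<open>R\<close>; \<open>room\<close> ensures that there are enough of them.\<close>

lemma cycle_step:
  assumes xs: "cyc xs" "W \<subseteq> set xs" "set xs \<subseteq> V"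
    and WR: "W \<inter> R = {}" "\<And>v. v \<in> V - R \<Longrightarrow> 3 * k + 2 \<le> card (nbh v W)"
    and k: "\<And>S. \<lbrakk>indep S; S \<subseteq> V\<rbrakk> \<Longrightarrow> card S \<le> k"
    and block: "s + 4 * k \<le> length xs" "4 * k + 3 \<le> length xs"
      "card {p \<in> {s..<s + 4 * k}. xs ! p \<in> W} < 2 * k"
    and room: "length xs - 1 + card R \<le> card V \<or> (\<forall>p\<in>{s..<s + 4 * k}. xs ! p \<notin> R)"
    and finR: "finite R"
  shows "\<exists>ys. cyc ys \<and> W \<subseteq> set ys \<and> set ys \<subseteq> V \<and> length ys = length xs - 1"
proof -
  let ?I = "{s..<s + 4 * k}"
  \<comment> \<open>Marking only positions outside \<open>W\<close> ensures that a lost vertex stays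
    lost when \<open>W\<close> is restored, so the length really drops.\<close>
  define T where "T = {p \<in> ?I. xs ! p \<notin> W}"
  have finW: "finite W" using xs(2) by (rule finite_subset) simp
  have T: "T = ?I - {p \<in> ?I. xs ! p \<in> W}" by (auto simp: T_def)
  have "card T = 4 * k - card {p \<in> ?I. xs ! p \<in> W}"
    unfolding T by (subst card_Diff_subset) auto
  then have cT: "2 * k + 1 \<le> card T" using block(3) by linarith
  have "\<exists>ys p. cyc ys \<and> set ys \<subseteq> set xs \<and> set xs - set ys \<subseteq> (!) xs ` ?I \<and> p \<in> T \<and> xs ! p \<notin> set ys"
    using xs(1) _ block(1) cT block(2)
  proof (rule cyc_shorten)
    show "T \<subseteq> ?I" by (auto simp: T_def)
    show "card S \<le> k" if "indep S" "S \<subseteq> set xs" for S using that xs(3) k by blast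
  qed
  then obtain ys p where ys: "cyc ys" "set ys \<subseteq> set xs" "set xs - set ys \<subseteq> (!) xs ` ?I"
    and p: "p \<in> T" "xs ! p \<notin> set ys" by blast
  define B where "B = W - set ys"
  have "B \<subseteq> (!) xs ` {p \<in> ?I. xs ! p \<in> W}" using ys(3) xs(2) by (auto simp: B_def)
  then have "card B \<le> card {p \<in> ?I. xs ! p \<in> W}" by (rule surj_card_le[rotated]) simp
  then have cB: "card B < 2 * k" using block(3) by linarith
  have finB: "finite B" using finW by (simp add: B_def)
  have "\<exists>zs. cyc zs \<and> set zs = set ys \<union> B"
    using finB ys(1)
  proof (rule cyc_absorb_set)
    show "B \<inter> set ys = {}" by (auto simp: B_def)
    show "k + 2 \<le> card (nbh b (set ys))" if "b \<in> B" for b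
    proof -
      have "b \<in> V - R" using that xs WR(1) by (auto simp: B_def)
      then have "3 * k + 2 \<le> card (nbh b W)" by (rule WR(2))
      also have "\<dots> \<le> card (nbh b (set ys) \<union> B)"
        using finB by (intro card_mono) (auto simp: nbh_def B_def)
      also have "\<dots> \<le> card (nbh b (set ys)) + card B" by (rule card_Un_le)
      finally show ?thesis using cB by simp
    qed
    show "card S \<le> k" if "indep S" "S \<subseteq> set ys \<union> B" for S
    proof -
      have "S \<subseteq> V" using that ys(2) xs by (auto simp: B_def)
      then show ?thesis using k that by blast
    qed
  qed
  then obtain zs where zs: "cyc zs" "set zs = set ys \<union> B" by blast
  have Wz: "W \<subseteq> set zs" using zs by (auto simp: B_def)
  have zx: "set zs \<subseteq> set xs" using zs ys xs by (auto simp: B_def)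
  have lenx: "card (set xs) = length xs" using xs(1) by (simp add: cyc_def distinct_card)
  have px: "xs ! p \<in> set xs - set zs"
    using p zs block(1) by (auto simp: T_def B_def)
  then have "card (set zs) < card (set xs)" using zx by (intro psubset_card_mono) auto
  then have cz: "card (set zs) \<le> length xs - 1" using lenx by simp
  \<comment> \<open>Either \<open>V - R\<close> is large enough by counting, or the block avoids
    \<open>R\<close> and the vertices just removed are themselves candidates.\<close>
  have "length xs - 1 - card (set zs) \<le> card (V - R - set zs)"
    using room
  proof
    assume "length xs - 1 + card R \<le> card V"
    moreover have "card V - card R \<le> card (V - R)" using finR by (rule diff_card_le_card_Diff)
    moreover have "card (V - R) - card (set zs) \<le> card (V - R - set zs)"
      by (rule diff_card_le_card_Diff) simp
    ultimately show ?thesis by linarith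
  next
    assume R: "\<forall>p\<in>?I. xs ! p \<notin> R"
    have "set xs - set zs \<subseteq> (!) xs ` ?I" using ys(3) zs by blast
    then have "set xs - set zs \<subseteq> V - R - set zs" using R xs(3) by blast
    then have "card (set xs - set zs) \<le> card (V - R - set zs)"
      using finite_V by (intro card_mono) auto
    moreover have "card (set xs - set zs) = length xs - card (set zs)"
      using zx lenx by (simp add: card_Diff_subset)
    ultimately show ?thesis by simp
  qed
  then obtain A where A: "A \<subseteq> V - R - set zs" "card A = length xs - 1 - card (set zs)" "finite A"
    by (rule obtain_subset_with_card_n)
  have "\<exists>ws. cyc ws \<and> set ws = set zs \<union> A"
    using A(3) zs(1)
  proof (rule cyc_absorb_set)
    show "A \<inter> set zs = {}" using A by blast
    show "k + 2 \<le> card (nbh a (set zs))" if "a \<in> A" for a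
    proof -
      have "3 * k + 2 \<le> card (nbh a W)" using that A WR(2) by blast
      also have "\<dots> \<le> card (nbh a (set zs))"
        using Wz by (intro card_mono finite_nbh nbh_mono finite_set)
      finally show ?thesis by simp
    qed
    show "card S \<le> k" if "indep S" "S \<subseteq> set zs \<union> A" for S
      using that A zx xs(3) by (intro k) auto
  qed
  then obtain ws where ws: "cyc ws" "set ws = set zs \<union> A" by blast
  have "length ws = card (set ws)" using ws(1) by (simp add: cyc_def distinct_card)
  also have "\<dots> = card (set zs) + card A"
    unfolding ws(2) using A by (intro card_Un_disjoint) auto
  also have "\<dots> = length xs - 1" using A(2) cz by simp
  finally show ?thesis using ws Wz zx xs(3) A by (intro exI[of _ ws]) auto
qed

section \<open>Short and long cycle lengths\<close>

text \<open>A path on \<open>l - 1\<close> neighbours of \<open>v\<close> closes through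
  \<open>v\<close> to an \<open>l\<close>-cycle, so under any injective key monotone paths in the
  neighbourhood have at most \<open>l - 2\<close> vertices.\<close>

lemma wheel_cycle:
  assumes "3 \<le> l" "finite U"
    and k: "\<And>S. \<lbrakk>indep S; S \<subseteq> U\<rbrakk> \<Longrightarrow> card S \<le> k"
    and nocyc: "\<And>zs. \<lbrakk>cyc zs; set zs \<subseteq> U\<rbrakk> \<Longrightarrow> length zs \<noteq> l"
    and v: "v \<in> U"
  shows "card (nbh v U) \<le> (l - 2) * k"
proof -
  obtain key :: "'a \<Rightarrow> nat" where key: "inj_on key U"
    using finite_imp_inj_to_nat_seg[OF assms(2)] by blast
  have "\<exists>I \<subseteq> nbh v U. indep I \<and> card (nbh v U) \<le> (l - 2) * card I"
  proof (rule mono_path_or_indep)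
    show "finite (nbh v U)" using assms(2) by (rule finite_nbh)
    show "inj_on key (nbh v U)" using key nbh_subset by (rule inj_on_subset)
    fix xs assume xs: "set xs \<subseteq> nbh v U" "successively E xs" "sorted_wrt (\<lambda>x y. key x < key y) xs"
    show "length xs \<le> l - 2"
    proof (rule ccontr)
      assume "\<not> length xs \<le> l - 2"
      define ys where "ys = take (l - 1) xs"
      have ys: "length ys = l - 1" "set ys \<subseteq> nbh v U" "ys \<noteq> []"
        using \<open>\<not> length xs \<le> l - 2\<close> xs(1) assms(1) set_take_subset[of "l - 1" xs] by (auto simp: ys_def)
      have "distinct ys" using sorted_wrt_imp_distinct[OF xs(3)] by (simp add: ys_def)
      moreover have "successively E ys"
        using xs(2) append_take_drop_id[of "l - 1" xs] unfolding ys_def by (metis successively_append_iff)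
      moreover have adj: "E v y" if "y \<in> set ys" for y using that ys(2) by (auto simp: nbh_def)
      then have "E v (hd ys)" "E v (last ys)" "v \<notin> set ys"
        using ys(3) E_irrefl by (simp, simp, blast)
      ultimately have "cyc (v # ys)"
        using ys assms(1) E_sym[OF \<open>E v (last ys)\<close>] by (auto simp: cyc_def successively_Cons)
      moreover have "set (v # ys) \<subseteq> U" using v ys(2) nbh_subset[of v U] by auto
      ultimately show False using nocyc[of "v # ys"] ys(1) assms(1) by simp
    qed
  qed
  then obtain I where I: "I \<subseteq> nbh v U" "indep I" "card (nbh v U) \<le> (l - 2) * card I" by blast
  have "card I \<le> k" using k[OF I(2)] I(1) nbh_subset by blast
  then have "(l - 2) * card I \<le> (l - 2) * k" by (rule mult_le_mono2)
  then show ?thesis using I(3) by linarith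
qed

text \<open>Without an \<open>l\<close>-cycle the graph is too small. If
  \<open>4 * k \<le> l\<close>, it has at most \<open>3 * (l - 2) * k\<close> vertices, less than
  \<open>3 * 50 * k ^ 2 * k\<close>, which accounts for the 150. Otherwise all degrees are below
  \<open>4 * k * k\<close>, which leaves at most \<open>4 * k ^ 3\<close> vertices.\<close>

lemma cycle_short:
  assumes "3 \<le> l" "l \<le> 50 * k ^ 2 + 1" "1 \<le> k" "150 * k ^ 3 \<le> card V"
    and k: "\<And>S. \<lbrakk>indep S; S \<subseteq> V\<rbrakk> \<Longrightarrow> card S \<le> k"
  shows "\<exists>zs. cyc zs \<and> set zs \<subseteq> V \<and> length zs = l"
proof (rule ccontr)
  assume no: "\<not> ?thesis"
  then have nocyc: "length zs \<noteq> l" if "cyc zs" "set zs \<subseteq> V" for zs using that by blast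
  have "card V < 150 * k ^ 3"
  proof (cases "4 * k \<le> l")
    case True
    obtain I where I: "I \<subseteq> V" "indep I" "card V \<le> 3 * (l - 2) * card I"
      using no_cycle_imp_large_indep[OF finite_V assms(1) True nocyc k] by blast
    have "card V \<le> 3 * (l - 2) * card I" by (rule I)
    also have "\<dots> \<le> 3 * (l - 2) * k" using k[OF I(2,1)] by (rule mult_le_mono2)
    also have "\<dots> < 3 * (50 * k ^ 2) * k" using assms(1-3) by simp
    also have "\<dots> = 150 * k ^ 3" by (simp add: power2_eq_square power3_eq_cube)
    finally show ?thesis .
  next
    case False
    have deg: "card (nbh v V) \<le> (l - 2) * k" if "v \<in> V" for v
      using wheel_cycle[OF assms(1) finite_V k nocyc that] .
    have "\<exists>v\<in>T. card (nbh v T) < 4 * k * k" if T: "T \<subseteq> V" "T \<noteq> {}" for T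
    proof -
      obtain v where v: "v \<in> T" using T by blast
      have "card (nbh v T) \<le> card (nbh v V)"
        using T finite_V by (intro card_mono finite_nbh nbh_mono)
      also have "\<dots> \<le> (l - 2) * k" using deg v T by blast
      also have "\<dots> < 4 * k * k" using False assms(1,3) by simp
      finally show ?thesis using v by blast
    qed
    from degenerate_imp_large_indep[OF finite_V this]
    obtain I where I: "I \<subseteq> V" "indep I" "card V \<le> 4 * k * k * card I" by blast
    have "card V \<le> 4 * k * k * card I" by (rule I)
    also have "\<dots> \<le> 4 * k * k * k" using k[OF I(2,1)] by (rule mult_le_mono2)
    also have "\<dots> < 150 * k ^ 3" using assms(3) by (simp add: power3_eq_cube)
    finally show ?thesis .
  qed
  then show False using assms(4) by simp
qed

text \<open>Descending induction from the Hamilton cycle, keeping the core \<open>W\<close> on the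
  cycle.\<close>

lemma cycle_long:
  assumes "50 * k ^ 2 \<le> l" "l \<le> card V" "1 \<le> k" "150 * k ^ 3 \<le> card V"
    and k: "\<And>S. \<lbrakk>indep S; S \<subseteq> V\<rbrakk> \<Longrightarrow> card S \<le> k"
    and ham: "cyc hs" "set hs = V"
  shows "\<exists>zs. cyc zs \<and> set zs \<subseteq> V \<and> length zs = l"
proof -
  \<comment> \<open>Minimum degree \<open>5 * k\<close> suffices because
    \<open>3 * k + 2 \<le> 5 * k\<close> for \<open>k \<ge> 1\<close>.\<close>
  have "1 \<le> 5 * k" using assms(3) by simp
  with finite_V have "\<exists>W R. W \<subseteq> V \<and> finite R \<and> W \<inter> R = {} \<and> card W \<le> 2 * (5 * k) * k
      \<and> card R \<le> 5 * k * k \<and> (\<forall>v\<in>V - R. 5 * k \<le> card (nbh v W))"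
    by (rule dominating_core) (rule k)
  then obtain W R where W: "W \<subseteq> V" "W \<inter> R = {}" "card W \<le> 2 * (5 * k) * k"
    and R: "card R \<le> 5 * k * k" "finite R"
    and "\<forall>v\<in>V - R. 5 * k \<le> card (nbh v W)"
    by blast
  have deg': "3 * k + 2 \<le> card (nbh v W)" if "v \<in> V - R" for v
    using bspec[OF \<open>\<forall>v\<in>V - R. 5 * k \<le> card (nbh v W)\<close> that] assms(3) by linarith
  have finW: "finite W" using W(1) finite_V by (rule finite_subset)
  have cW: "card W \<le> 10 * (k * k)" and cR: "card R \<le> 5 * (k * k)"
    using W(3) R(1) by (simp_all add: mult.assoc)
  have kk: "1 \<le> k * k" "k \<le> k * k" "k * k \<le> k * k * k" using assms(3) by auto
  from assms(2) have "\<exists>zs. cyc zs \<and> W \<subseteq> set zs \<and> set zs \<subseteq> V \<and> length zs = l"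
  proof (induction l rule: inc_induct)
    case base
    show ?case using ham W(1) distinct_card[of hs] by (intro exI[of _ hs]) (auto simp: cyc_def)
  next
    case (step m)
    then obtain xs where xs: "cyc xs" "W \<subseteq> set xs" "set xs \<subseteq> V" "length xs = Suc m" by blast
    have dist: "distinct xs" using xs(1) by (simp add: cyc_def)
    have m: "50 * (k * k) \<le> m" using step(1) assms(1) by (simp add: power2_eq_square)
    have "\<exists>s. s + 4 * k \<le> length xs \<and> card {p \<in> {s..<s + 4 * k}. xs ! p \<in> W} < 2 * k
      \<and> (length xs - 1 + card R \<le> card V \<or> (\<forall>p\<in>{s..<s + 4 * k}. xs ! p \<notin> R))"
    proof (cases "m + card R \<le> card V")
      case True
      \<comment> \<open>Enough vertices are off the cycle, so the block may meet \<open>R\<close>.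
        The \<open>12 * k\<close> blocks of length \<open>4 * k\<close> fit into
        \<open>50 * (k * k)\<close> positions, and \<open>W\<close> is too small to meet each of
        them \<open>2 * k\<close> times.\<close>
      have "12 * k * (2 * k) = 24 * (k * k)" "12 * k * (4 * k) = 48 * (k * k)" by simp_all
      then have c: "card W < 12 * k * (2 * k)" and b: "12 * k * (4 * k) \<le> length xs"
        using cW m kk(1) xs(4) by linarith+
      from block_with_few[OF dist b finW c] show ?thesis using True xs(4) by auto
    next
      case False
      \<comment> \<open>Now the cycle misses fewer than \<open>card R\<close> vertices, so its
        length is of order \<open>k ^ 3\<close>. There is room for \<open>16 * (k * k)\<close>
        blocks, more than \<open>W \<union> R\<close> has vertices, and some block avoids both
        sets.\<close>
      have "card (W \<union> R) \<le> card W + card R" by (rule card_Un_le)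
      also have "\<dots> < 16 * (k * k) * 1" using cW cR kk(1) by linarith
      finally have c: "card (W \<union> R) < 16 * (k * k) * 1" .
      have "150 * (k * k * k) \<le> card V" using assms(4) by (simp add: power3_eq_cube mult.assoc)
      moreover have "16 * (k * k) * (4 * k) = 64 * (k * k * k)" by simp
      ultimately have "16 * (k * k) * (4 * k) \<le> length xs"
        using False cR kk(3) xs(4) by linarith
      then obtain s where s: "s + 4 * k \<le> length xs"
        "card {p \<in> {s..<s + 4 * k}. xs ! p \<in> W \<union> R} < 1"
        using block_with_few[OF dist _ _ c, of "4 * k"] finW R(2) by auto
      then have e: "{p \<in> {s..<s + 4 * k}. xs ! p \<in> W \<union> R} = {}" by simp
      then have "{p \<in> {s..<s + 4 * k}. xs ! p \<in> W} = {}" and R: "\<forall>p\<in>{s..<s + 4 * k}. xs ! p \<notin> R"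
        by blast+
      then have "card {p \<in> {s..<s + 4 * k}. xs ! p \<in> W} = 0" by (simp only: card.empty)
      then have "card {p \<in> {s..<s + 4 * k}. xs ! p \<in> W} < 2 * k" using assms(3) by linarith
      then show ?thesis using s(1) R by blast
    qed
    then obtain s where s: "s + 4 * k \<le> length xs" "card {p \<in> {s..<s + 4 * k}. xs ! p \<in> W} < 2 * k"
      "length xs - 1 + card R \<le> card V \<or> (\<forall>p\<in>{s..<s + 4 * k}. xs ! p \<notin> R)" by blast
    have "4 * k + 3 \<le> length xs" using m kk xs(4) by linarith
    from cycle_step[OF xs(1-3) W(2) deg' k s(1) this s(2,3) R(2)] show ?case using xs(4) by simp
  qed
  then show ?thesis by blast
qed

lemma pancyclic_if_hamiltonian:
  assumes "3 \<le> l" "l \<le> card V" "1 \<le> k" "150 * k ^ 3 \<le> card V"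
    and "\<And>S. \<lbrakk>indep S; S \<subseteq> V\<rbrakk> \<Longrightarrow> card S \<le> k"
    and "cyc hs" "set hs = V"
  shows "\<exists>zs. cyc zs \<and> set zs \<subseteq> V \<and> length zs = l"
  using cycle_short[OF assms(1) _ assms(3-5)] cycle_long[OF _ assms(2-7)]
  by (cases "l \<le> 50 * k ^ 2 + 1") simp_all

end

subsection \<open>Cycles as arc walks\<close>

fun arcs_along :: "'a list \<Rightarrow> ('a \<times> 'a) list" where
  "arcs_along (x # y # zs) = (x, y) # arcs_along (y # zs)"
| "arcs_along _ = []"

lemma length_arcs_along: "length (arcs_along xs) = length xs - 1"
  by (induction xs rule: arcs_along.induct) auto

lemma pcas_arcs_along: "xs \<noteq> [] \<Longrightarrow> pcas (hd xs) (arcs_along xs) (last xs)"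
  by (induction xs rule: arcs_along.induct) auto

lemma pawalk_verts_arcs_along: "xs \<noteq> [] \<Longrightarrow> pawalk_verts (hd xs) (arcs_along xs) = xs"
  by (induction xs rule: arcs_along.induct) auto

lemma set_arcs_along: "set (arcs_along xs) \<subseteq> A \<longleftrightarrow> successively (\<lambda>x y. (x, y) \<in> A) xs"
  by (induction xs rule: arcs_along.induct) auto

lemma arcs_along_pawalk_verts: "pcas u p v \<Longrightarrow> arcs_along (pawalk_verts u p) = p"
proof (induction p arbitrary: u)
  case (Cons e p)
  then show ?case by (cases p) (auto simp: prod_eq_iff)
qed simp

lemma length_pawalk_verts: "length (pawalk_verts u p) = Suc (length p)"
  by (induction p arbitrary: u) auto

lemma last_pawalk_verts: "pcas u p v \<Longrightarrow> last (pawalk_verts u p) = v"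
  by (induction p arbitrary: u) (auto, (metis length_pawalk_verts list.size(3) nat.distinct(1))+)

text \<open>Repeating the head at the end turns the implicit closing edge into an arc, so there are
  as many arcs as vertices in \<open>xs\<close>.\<close>

lemma cycle_arcs_along:
  assumes "distinct xs" "2 \<le> length xs" "successively (\<lambda>x y. (x, y) \<in> parcs G) xs"
    and "(last xs, hd xs) \<in> parcs G" "set xs \<subseteq> pverts G"
  shows "pre_digraph.cycle (with_proj G) (arcs_along (xs @ [hd xs]))"
proof -
  let ?p = "arcs_along (xs @ [hd xs])"
  have "xs \<noteq> []" using assms(2) by auto
  then have hd: "hd (xs @ [hd xs]) = hd xs" by simp
  have "pcas (hd xs) ?p (hd xs)" "pawalk_verts (hd xs) ?p = xs @ [hd xs]"
    using pcas_arcs_along[of "xs @ [hd xs]"] pawalk_verts_arcs_along[of "xs @ [hd xs]"] hd by auto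
  moreover have "set ?p \<subseteq> parcs G"
    unfolding set_arcs_along using assms(3,4) by (auto simp: successively_append_iff)
  moreover have "hd xs \<in> pverts G" using assms(5) \<open>xs \<noteq> []\<close> by auto
  moreover have "distinct (tl (xs @ [hd xs]))"
    using assms(1) \<open>xs \<noteq> []\<close> by (cases xs) auto
  moreover have "?p \<noteq> []" using length_arcs_along[of "xs @ [hd xs]"] \<open>xs \<noteq> []\<close> by auto
  ultimately show ?thesis
    by (auto simp: pre_digraph.cycle_def pre_digraph.awalk_def cas_with_proj_eq awalk_verts_with_proj_eq)
qed

text \<open>A closed walk lists its start twice. Dropping the first occurrence leaves a list ending
  in the start, whose closing edge is the first arc of the walk.\<close>

lemma cycle_vertex_list:
  assumes "pre_digraph.cycle (with_proj G) p" "pair_wf_digraph G"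
  obtains xs where "distinct xs" "length xs = length p" "set xs \<subseteq> pverts G"
    "successively (\<lambda>x y. (x, y) \<in> parcs G) xs" "(last xs, hd xs) \<in> parcs G"
proof -
  interpret pair_wf_digraph G by (rule assms(2))
  obtain u where u: "set p \<subseteq> parcs G" "pcas u p u" "distinct (tl (pawalk_verts u p))" "p \<noteq> []"
    using assms(1)
    by (auto simp: pre_digraph.cycle_def pre_digraph.awalk_def cas_with_proj_eq awalk_verts_with_proj_eq)
  define xs where "xs = tl (pawalk_verts u p)"
  have len: "length xs = length p" by (simp add: xs_def length_pawalk_verts)
  then have "xs \<noteq> []" using u(4) by auto
  have vs: "pawalk_verts u p = u # xs" using u(4) by (cases p) (use u(2) in \<open>auto simp: xs_def\<close>)
  have "last xs = u" using last_pawalk_verts[OF u(2)] vs \<open>xs \<noteq> []\<close> by simp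
  have "successively (\<lambda>x y. (x, y) \<in> parcs G) (u # xs)"
    using set_arcs_along[of "u # xs" "parcs G"] arcs_along_pawalk_verts[OF u(2)] vs u(1) by simp
  then have s: "successively (\<lambda>x y. (x, y) \<in> parcs G) xs" "(last xs, hd xs) \<in> parcs G"
    using \<open>xs \<noteq> []\<close> \<open>last xs = u\<close> by (auto simp: successively_Cons)
  have "set xs \<subseteq> snd ` set p"
  proof -
    have "set (tl (pawalk_verts w q)) \<subseteq> snd ` set q" if "pcas w q v" for w v and q :: "('a \<times> 'a) list"
      using that
    proof (induction q arbitrary: w)
      case (Cons e q)
      then show ?case by (cases q) auto
    qed simp
    then show ?thesis using u(2) by (simp add: xs_def)
  qed
  moreover have "snd ` set p \<subseteq> pverts G" using u(1) arc_snd_in_verts by blast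
  ultimately have "set xs \<subseteq> pverts G" by blast
  then show ?thesis using that[of xs] u(3) len s by (simp add: xs_def)
qed

section \<open>Transfer of the result to the locale \<open>pair_graph\<close>\<close>

theorem theorem1p2:
  fixes G :: "'a pair_pre_digraph"
  assumes "pair_graph G"
    and "pverts G \<noteq> {}"
    and "hamiltonian G"
    and "card (pverts G) \<ge> 150 * independence_number G ^ 3"
  shows "pancyclic G"
proof -
  interpret pair_graph G by (rule assms(1))
  let ?V = "pverts G" and ?E = "\<lambda>x y. (x, y) \<in> parcs G" and ?k = "independence_number G"
  interpret sgraph ?V ?E
  proof
    show "finite ?V" by (rule pair_finite_verts)
    show "(y, x) \<in> parcs G" if "(x, y) \<in> parcs G" for x y
      using pair_sym_arcs that by (auto simp: symmetric_def dest: symD)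
    show "(x, x) \<notin> parcs G" for x using pair_no_loops[of "(x, x)"] by auto
  qed
  have fin: "finite {card S | S. independent_set G S}"
    using finite_V by (auto simp: independent_set_def intro: finite_subset[of _ "card ` Pow ?V"])
  have k: "card S \<le> ?k" if "indep S" "S \<subseteq> ?V" for S
    unfolding independence_number_def using fin
    by (rule Max_ge) (use that in \<open>auto simp: indep_def independent_set_def\<close>)
  obtain v where "v \<in> ?V" using assms(2) by blast
  then have "1 \<le> ?k" using k[of "{v}"] E_irrefl by (simp add: indep_def)
  obtain p where p: "3 \<le> card ?V" "pre_digraph.cycle (with_proj G) p" "length p = card ?V"
    using assms(3) by (auto simp: hamiltonian_def has_cycle_of_length_def)
  obtain hs where hs: "distinct hs" "length hs = length p" "set hs \<subseteq> ?V" "successively ?E hs"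
    "?E (last hs) (hd hs)"
    using cycle_vertex_list[OF p(2) pair_wf_digraph_axioms] by blast
  have "cyc hs" using hs p by (simp add: cyc_def)
  have "set hs = ?V"
    using hs p finite_V by (intro card_subset_eq) (auto simp: distinct_card)
  have "has_cycle_of_length G l" if l: "3 \<le> l" "l \<le> card ?V" for l
  proof -
    obtain zs where zs: "cyc zs" "set zs \<subseteq> ?V" "length zs = l"
      using pancyclic_if_hamiltonian[OF l \<open>1 \<le> ?k\<close> assms(4) k \<open>cyc hs\<close> \<open>set hs = ?V\<close>] by blast
    then have "pre_digraph.cycle (with_proj G) (arcs_along (zs @ [hd zs]))"
      by (intro cycle_arcs_along) (auto simp: cyc_def)
    moreover have "length (arcs_along (zs @ [hd zs])) = l" using zs by (simp add: length_arcs_along)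
    ultimately show ?thesis using l(1) unfolding has_cycle_of_length_def by blast
  qed
  then show ?thesis by (simp add: pancyclic_def)
qed

end
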